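(* Consider the distributed price-update algorithm described in the context, under its assumptions. If for each company $k\in\mathcal{K}$ at time $t\in\mathcal{T}$ in iteration $i\in\{0,1,2,\dots\}$ the prices are sequentially updated using $$p_k^{(i+1)}(t)=p_k^{(i)}(t)+\frac{\sum_{n\in\mathcal{N}}d^{(i)}_{n,k}(t)-G_k(t)}{\epsilon^{(i)}_{k,t}}\qquad\text{with}\qquad \epsilon^{(i)}_{k,t}=\frac{G_k(t)+N}{p_k^{(i)}(t)}+\delta,$$ where $\delta\ge 0$, then the algorithm converges to the optimal prices, i.e. for all $k\in\mathcal{K}$, $t\in\mathcal{T}$, as $i\to\infty$, $$p_k^{(i)}(t)\ \to\ p_k^*(t)=\frac{B}{G_k(t)+N}\left(\frac{1}{KT-\sum_{j\in\mathcal{K}}\sum_{h\in\mathcal{T}}\frac{N}{G_j(h)+N}}\right),\qquad B=\sum_{n\in\mathcal{N}}B_n .$$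
   Context: $\mathcal{K}=\{1,\dots,K\}$ is the set of companies, $\mathcal{N}=\{1,\dots,N\}$ the set of consumers, $\mathcal{T}=\{1,\dots,T\}$ the set of time slots. Power availabilities $G_k(t)>0$ are fixed. Consumer $n$ has budget $B_n\ge0$ (with $B=\sum_n B_n>0$), minimum energy need $E_n^{\min}\ge0$, and utility parameters $\gamma_n=\zeta_n=1$ (utility $\sum_{k,t}\ln(1+d_{n,k}(t))$). Budget assumption: $B_n\ge \frac{E_n^{\min}+KT}{\sum_{k,t}\frac{1}{KTp_k(t)}}-\sum_{k,t}p_k(t)$ for each $n$, for the announced prices. Algorithm: Start with arbitrary positive prices $p_k^{(0)}(t)$, $k\in\mathcal{K}$, $t\in\mathcal{T}$. In each iteration $i$, the pairs $(k,t)\in\mathcal{K}\times\mathcal{T}$ are processed one at a time, each once, in some order. When $(k,t)$ is processed, its price $p_k^{(i)}(t)$ is replaced by $p_k^{(i+1)}(t)$ according to the update rule, where $d^{(i)}_{n,k}(t)$ is the consumers' demand computed from the most recently announced prices $p_j(h)$ (those already updated in the current iteration and the old ones otherwise): $$d^{(i)}_{n,k}(t)=\frac{B_n+\sum_{j\in\mathcal{K}}\sum_{h\in\mathcal{T}}p_j(h)}{KT\,p^{(i)}_k(t)}-1 .$$ After each price change, consumers recompute their demands. The algorithm stops if $p_k^{(i+1)}(t)=p_k^{(i)}(t)$ for all $k,t$ (in which case the prices are regarded as constant from then on). *)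

theory Defs
  imports Complex_Main
begin

text \<open>
  Companies are \<open>{1..K}\<close>, time slots \<open>{1..T}\<close>, consumers \<open>{1..N}\<close>.  A price vector
  \<open>p\<close> gives the price \<open>p k t\<close> of company \<open>k\<close> at time \<open>t\<close>; values outside the index range are
  irrelevant and never change.
\<close>

type_synonym prices = "nat \<Rightarrow> nat \<Rightarrow> real"

definition total_price :: "nat \<Rightarrow> nat \<Rightarrow> prices \<Rightarrow> real" where
  "total_price K T p = (\<Sum>j\<in>{1..K}. \<Sum>h\<in>{1..T}. p j h)"

text \<open>
  Demand of a consumer with budget \<open>b\<close> and \<open>\<gamma> = \<zeta> = 1\<close>.  As in the closed-form expression it is
  not truncated at zero.
\<close>

definition demand :: "nat \<Rightarrow> nat \<Rightarrow> real \<Rightarrow> prices \<Rightarrow> nat \<Rightarrow> nat \<Rightarrow> real" where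
  "demand K T b p k t = (b + total_price K T p) / (real K * real T * p k t) - 1"

definition budget_sufficient :: "nat \<Rightarrow> nat \<Rightarrow> real \<Rightarrow> real \<Rightarrow> prices \<Rightarrow> bool" where
  "budget_sufficient K T b e p \<longleftrightarrow>
     b \<ge> (e + real K * real T) / (\<Sum>k\<in>{1..K}. \<Sum>t\<in>{1..T}. 1 / (real K * real T * p k t))
          - total_price K T p"

definition step_eps :: "nat \<Rightarrow> (nat \<Rightarrow> nat \<Rightarrow> real) \<Rightarrow> real \<Rightarrow> prices \<Rightarrow> nat \<Rightarrow> nat \<Rightarrow> real" where
  "step_eps N G \<delta> p k t = (G k t + real N) / p k t + \<delta>"

definition new_price ::
  "nat \<Rightarrow> nat \<Rightarrow> nat \<Rightarrow> (nat \<Rightarrow> nat \<Rightarrow> real) \<Rightarrow> (nat \<Rightarrow> real) \<Rightarrow> real \<Rightarrow> prices \<Rightarrow> nat \<Rightarrow> nat \<Rightarrow> real" where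
  "new_price K T N G b \<delta> p k t =
     p k t + ((\<Sum>n\<in>{1..N}. demand K T (b n) p k t) - G k t) / step_eps N G \<delta> p k t"

fun process_pair ::
  "nat \<Rightarrow> nat \<Rightarrow> nat \<Rightarrow> (nat \<Rightarrow> nat \<Rightarrow> real) \<Rightarrow> (nat \<Rightarrow> real) \<Rightarrow> real \<Rightarrow> nat \<times> nat \<Rightarrow> prices \<Rightarrow> prices" where
  "process_pair K T N G b \<delta> (k, t) p = p(k := (p k)(t := new_price K T N G b \<delta> p k t))"

text \<open>
  Pairs are processed from left to right, each step using the prices left by the previous one.
\<close>

definition process_pairs ::
  "nat \<Rightarrow> nat \<Rightarrow> nat \<Rightarrow> (nat \<Rightarrow> nat \<Rightarrow> real) \<Rightarrow> (nat \<Rightarrow> real) \<Rightarrow> real \<Rightarrow> (nat \<times> nat) list \<Rightarrow> prices \<Rightarrow> prices" where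
  "process_pairs K T N G b \<delta> xs p = fold (process_pair K T N G b \<delta>) xs p"

definition processing_order :: "nat \<Rightarrow> nat \<Rightarrow> (nat \<times> nat) list \<Rightarrow> bool" where
  "processing_order K T xs \<longleftrightarrow> distinct xs \<and> set xs = {1..K} \<times> {1..T}"

text \<open>The algorithm has stopped before iteration \<open>i\<close>.\<close>

definition stopped :: "nat \<Rightarrow> nat \<Rightarrow> (nat \<Rightarrow> prices) \<Rightarrow> nat \<Rightarrow> bool" where
  "stopped K T p i \<longleftrightarrow> (\<exists>j<i. \<forall>k\<in>{1..K}. \<forall>t\<in>{1..T}. p (Suc j) k t = p j k t)"

text \<open>
  \<open>p i\<close> is the price vector at the beginning of iteration \<open>i\<close>, and \<open>ord i\<close> the order used in that
  iteration; it may change from one iteration to the next.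
\<close>

definition algorithm_run ::
  "nat \<Rightarrow> nat \<Rightarrow> nat \<Rightarrow> (nat \<Rightarrow> nat \<Rightarrow> real) \<Rightarrow> (nat \<Rightarrow> real) \<Rightarrow> real
    \<Rightarrow> (nat \<Rightarrow> (nat \<times> nat) list) \<Rightarrow> (nat \<Rightarrow> prices) \<Rightarrow> bool" where
  "algorithm_run K T N G b \<delta> ord p \<longleftrightarrow>
     (\<forall>k\<in>{1..K}. \<forall>t\<in>{1..T}. p 0 k t > 0) \<and>
     (\<forall>i. processing_order K T (ord i)) \<and>
     (\<forall>i. p (Suc i) = (if stopped K T p i then p i
                       else process_pairs K T N G b \<delta> (ord i) (p i)))"

text \<open>
  All price vectors seen by the consumers: those at the beginning of an iteration (\<open>m = 0\<close>) and
  those after each single price change within an iteration.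
\<close>

definition announced_prices ::
  "nat \<Rightarrow> nat \<Rightarrow> nat \<Rightarrow> (nat \<Rightarrow> nat \<Rightarrow> real) \<Rightarrow> (nat \<Rightarrow> real) \<Rightarrow> real
    \<Rightarrow> (nat \<Rightarrow> (nat \<times> nat) list) \<Rightarrow> (nat \<Rightarrow> prices) \<Rightarrow> prices set" where
  "announced_prices K T N G b \<delta> ord p =
     range p \<union>
     {process_pairs K T N G b \<delta> (take m (ord i)) (p i) | i m. \<not> stopped K T p i}"

definition optimal_price ::
  "nat \<Rightarrow> nat \<Rightarrow> nat \<Rightarrow> (nat \<Rightarrow> nat \<Rightarrow> real) \<Rightarrow> (nat \<Rightarrow> real) \<Rightarrow> nat \<Rightarrow> nat \<Rightarrow> real" where
  "optimal_price K T N G b k t =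
     (\<Sum>n\<in>{1..N}. b n) / (G k t + real N) *
     (1 / (real K * real T - (\<Sum>j\<in>{1..K}. \<Sum>h\<in>{1..T}. real N / (G j h + real N))))"

end

theory Submission
  imports Defs
begin

text \<open>
  Write \<open>c k t = G k t + N\<close>, \<open>M = K T\<close>, and \<open>S\<close> for the total price.  The aggregate excess demand
  is \<open>(B + N S) / (M p k t) - c k t\<close>, so with \<open>\<lambda> = c / (c + \<delta> p)\<close>, a number in \<open>(0, 1]\<close>, the
  update becomes
  \<open>p' = (1 - \<lambda>) p + \<lambda> F\<close> with \<open>F = (B + N S) / (M c)\<close>.
  The algorithm is thus an under-relaxed Gauss-Seidel iteration for the affine map \<open>F\<close>, whose
  fixed point is the optimal price (lemma \<open>clearing\<close>).

  Measure the distance of a price vector from the optimum by its largest \<^emph>\<open>relative\<close> error \<open>D\<close>.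
  A relative error of at most \<open>D\<close> in every price makes an error of at most \<open>D S\<^sup>*\<close> in \<open>S\<close>.
  Since the budgets contribute the positive constant \<open>B\<close>, only the fraction
  \<open>N S\<^sup>* / (B + N S\<^sup>*) < 1\<close> of the relative error survives in \<open>F\<close>.  Hence processing a pair brings
  its own error below \<open>q D\<close> and leaves the others alone, for a \<open>q < 1\<close> that is uniform
  because \<open>\<lambda>\<close> stays away from \<open>0\<close> while the prices are bounded (lemma \<open>new_price_contracts\<close>).
  As no error ever exceeds the initial bound, the prices are bounded.  A full sweep treats
  every pair, so in whatever order it runs it multiplies the largest error by at most \<open>q\<close>
  (lemma \<open>sweep_contracts\<close>).

  If a sweep changes nothing, then \<open>D \<le> q D\<close> forces \<open>D = 0\<close>: the algorithm can stop only at
  the optimum, and the geometric decay persists after stopping (lemma \<open>run_contracts\<close>).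
\<close>

section \<open>The optimal prices as a fixed point\<close>

locale market =
  fixes K T N :: nat
    and G :: "nat \<Rightarrow> nat \<Rightarrow> real"
    and b :: "nat \<Rightarrow> real"
    and \<delta> :: real
  assumes K_pos: "K \<ge> 1" and T_pos: "T \<ge> 1"
    and G_pos: "\<And>k t. k \<in> {1..K} \<Longrightarrow> t \<in> {1..T} \<Longrightarrow> G k t > 0"
    and budget_pos: "(\<Sum>n\<in>{1..N}. b n) > 0"
    and \<delta>_nonneg: "\<delta> \<ge> 0"
begin

definition B :: real where "B = (\<Sum>n\<in>{1..N}. b n)"

definition M :: real where "M = real K * real T"

definition c :: "nat \<Rightarrow> nat \<Rightarrow> real" where "c k t = G k t + real N"

text \<open>The constant for which \<open>B / slack\<close> is the common value of \<open>c p\<close> at the optimum.\<close>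

definition slack :: real where
  "slack = M - (\<Sum>j\<in>{1..K}. \<Sum>h\<in>{1..T}. real N / c j h)"

abbreviation popt :: prices where "popt \<equiv> optimal_price K T N G b"

abbreviation grid :: "(nat \<times> nat) set" where "grid \<equiv> {1..K} \<times> {1..T}"

lemma B_pos: "B > 0"
  using budget_pos by (simp add: B_def)

lemma M_pos: "M > 0"
  using K_pos T_pos by (simp add: M_def)

lemma N_pos: "N \<ge> 1"
  using budget_pos by (cases N) auto

lemma c_gt_N: "(k, t) \<in> grid \<Longrightarrow> c k t > real N"
  using G_pos[of k t] by (simp add: c_def)

lemma c_ge_1: "(k, t) \<in> grid \<Longrightarrow> c k t \<ge> 1"
  using c_gt_N[of k t] N_pos by (simp add: le_less_trans less_imp_le)

lemma finite_grid: "finite grid"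
  and grid_nonempty: "grid \<noteq> {}"
  using K_pos T_pos by auto

lemma total_price_grid: "total_price K T p = (\<Sum>(k, t)\<in>grid. p k t)"
  by (simp add: total_price_def sum.cartesian_product)

lemma slack_grid: "slack = M - (\<Sum>(k, t)\<in>grid. real N / c k t)"
  by (simp add: slack_def sum.cartesian_product)

text \<open>This is where positive availabilities enter: each of the \<open>M\<close> quotients is below \<open>1\<close>.\<close>

lemma slack_pos: "slack > 0"
proof -
  have "(\<Sum>(k, t)\<in>grid. real N / c k t) < (\<Sum>x\<in>grid. 1)"
  proof (rule sum_strict_mono[OF finite_grid grid_nonempty])
    fix x assume x: "x \<in> grid"
    obtain k t where kt: "x = (k, t)" by (cases x)
    show "(case x of (k, t) \<Rightarrow> real N / c k t) < 1"
      using c_gt_N[of k t] c_ge_1[of k t] x kt by simp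
  qed
  also have "\<dots> = M"
    by (simp add: M_def)
  finally show ?thesis
    by (simp add: slack_grid)
qed

lemma slack_le_M: "slack \<le> M"
proof -
  have "0 \<le> (\<Sum>(k, t)\<in>grid. real N / c k t)"
    by (intro sum_nonneg) (use c_ge_1 in fastforce)
  then show ?thesis
    by (simp add: slack_grid)
qed

lemma popt_eq: "popt k t = B / slack / c k t"
  by (simp add: optimal_price_def slack_def B_def M_def c_def)

lemma popt_pos: "(k, t) \<in> grid \<Longrightarrow> popt k t > 0"
  using B_pos slack_pos c_ge_1[of k t] by (simp add: popt_eq)

lemma total_popt: "real N * total_price K T popt = B * (M - slack) / slack"
proof -
  have "real N * total_price K T popt = (\<Sum>(k, t)\<in>grid. B / slack * (real N / c k t))"
    by (simp add: total_price_grid popt_eq sum_distrib_left case_prod_unfold mult_ac)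
  also have "\<dots> = B / slack * (\<Sum>(k, t)\<in>grid. real N / c k t)"
    by (simp add: sum_distrib_left case_prod_unfold)
  also have "\<dots> = B / slack * (M - slack)"
    by (simp add: slack_grid)
  finally show ?thesis
    by simp
qed

text \<open>
  The optimum is a fixed point of the target map: there \<open>c p\<close> has the same value \<open>B / slack\<close> at
  every pair, and this is the share \<open>1 / M\<close> of \<open>B + N S\<close>.
\<close>

lemma clearing:
  assumes "(k, t) \<in> grid"
  shows "(B + real N * total_price K T popt) / (M * c k t) = popt k t"
proof -
  have "B + real N * total_price K T popt = B * M / slack"
    using slack_pos by (simp add: total_popt field_simps)
  then show ?thesis
    using M_pos by (simp add: popt_eq)
qed

text \<open>
  The quotient in \<open>clearing\<close> splits into a part from the budgets and a part from the prices.
  Only the second inherits errors of the prices, and it is the fraction \<open>1 - slack / M < 1\<close>.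
\<close>

lemma price_share:
  assumes "(k, t) \<in> grid"
  shows "real N * total_price K T popt / (M * c k t) = (1 - slack / M) * popt k t"
  using slack_pos M_pos c_ge_1[OF assms]
  by (simp add: total_popt popt_eq field_simps)

section \<open>One price update\<close>

definition target :: "prices \<Rightarrow> nat \<Rightarrow> nat \<Rightarrow> real" where
  "target p k t = (B + real N * total_price K T p) / (M * c k t)"

definition relaxation :: "prices \<Rightarrow> nat \<Rightarrow> nat \<Rightarrow> real" where
  "relaxation p k t = c k t / (c k t + \<delta> * p k t)"

lemma new_price_relaxed:
  assumes "(k, t) \<in> grid" and "p k t > 0"
  shows "new_price K T N G b \<delta> p k t
           = (1 - relaxation p k t) * p k t + relaxation p k t * target p k t"
proof -
  let ?S = "total_price K T p"
  have c: "c k t > 0"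
    using c_ge_1[OF assms(1)] by simp
  have den: "c k t + \<delta> * p k t > 0"
    using c assms(2) \<delta>_nonneg by (simp add: add_pos_nonneg)
  have "(\<Sum>n\<in>{1..N}. demand K T (b n) p k t) = (B + real N * ?S) / (M * p k t) - real N"
    by (simp add: demand_def sum_subtractf sum_divide_distrib[symmetric] sum.distrib B_def M_def)
  then have "new_price K T N G b \<delta> p k t
      = p k t + ((B + real N * ?S) / (M * p k t) - c k t) / (c k t / p k t + \<delta>)"
    by (simp add: new_price_def step_eps_def c_def)
  also have "(B + real N * ?S) / (M * p k t) - c k t = c k t * (target p k t - p k t) / p k t"
    using assms(2) c M_pos by (simp add: target_def field_simps)
  also have "c k t / p k t + \<delta> = (c k t + \<delta> * p k t) / p k t"
    using assms(2) by (simp add: field_simps)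
  also have "c k t * (target p k t - p k t) / p k t / ((c k t + \<delta> * p k t) / p k t)
      = relaxation p k t * (target p k t - p k t)"
    using assms(2) by (simp add: relaxation_def)
  finally show ?thesis
    by (simp add: algebra_simps)
qed

lemma relaxation_bounds:
  assumes "(k, t) \<in> grid" and "p k t > 0"
  shows "0 < relaxation p k t" and "relaxation p k t \<le> 1"
proof -
  have "c k t > 0" and "\<delta> * p k t \<ge> 0"
    using c_ge_1[OF assms(1)] assms(2) \<delta>_nonneg by auto
  then show "0 < relaxation p k t" and "relaxation p k t \<le> 1"
    by (simp_all add: relaxation_def add_pos_nonneg)
qed

definition positive :: "prices \<Rightarrow> bool" where
  "positive p \<longleftrightarrow> (\<forall>(k, t)\<in>grid. p k t > 0)"

definition rel_error_le :: "real \<Rightarrow> prices \<Rightarrow> bool" where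
  "rel_error_le D p \<longleftrightarrow> (\<forall>(k, t)\<in>grid. \<bar>p k t - popt k t\<bar> \<le> D * popt k t)"

lemma new_price_pos:
  assumes "positive p" and "(k, t) \<in> grid"
  shows "new_price K T N G b \<delta> p k t > 0"
proof -
  have p: "p k t > 0"
    using assms by (auto simp: positive_def)
  have "total_price K T p \<ge> 0"
    using assms(1) unfolding total_price_grid positive_def
    by (intro sum_nonneg) (auto simp: less_imp_le)
  then have "target p k t > 0"
    using B_pos M_pos c_ge_1[OF assms(2)] by (simp add: target_def add_pos_nonneg)
  then have "relaxation p k t * target p k t > 0"
    using relaxation_bounds(1)[of k t p, OF assms(2) p] by simp
  moreover have "(1 - relaxation p k t) * p k t \<ge> 0"
    using relaxation_bounds(2)[of k t p, OF assms(2) p] p by simp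
  ultimately show ?thesis
    using new_price_relaxed[of k t p, OF assms(2) p] by simp
qed

text \<open>
  The target depends on the prices only through their total, whose relative error is at most \<open>D\<close>;
  the budgets, which carry no error, dilute it.
\<close>

lemma target_contracts:
  assumes "rel_error_le D p" and "(k, t) \<in> grid"
  shows "\<bar>target p k t - popt k t\<bar> \<le> (1 - slack / M) * D * popt k t"
proof -
  let ?S = "total_price K T p" and ?S' = "total_price K T popt"
  have Mc: "M * c k t > 0"
    using M_pos c_ge_1[OF assms(2)] by simp
  have "\<bar>?S - ?S'\<bar> = \<bar>\<Sum>(j, h)\<in>grid. p j h - popt j h\<bar>"
    by (simp add: total_price_grid sum_subtractf case_prod_unfold)
  also have "\<dots> \<le> (\<Sum>(j, h)\<in>grid. \<bar>p j h - popt j h\<bar>)"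
    by (simp add: case_prod_unfold sum_abs)
  also have "\<dots> \<le> (\<Sum>(j, h)\<in>grid. D * popt j h)"
    using assms(1) by (intro sum_mono) (auto simp: rel_error_le_def)
  also have "\<dots> = D * ?S'"
    by (simp add: total_price_grid sum_distrib_left case_prod_unfold)
  finally have S: "\<bar>?S - ?S'\<bar> \<le> D * ?S'" .
  have "target p k t - popt k t = real N * (?S - ?S') / (M * c k t)"
    unfolding clearing[OF assms(2), symmetric] target_def
    by (simp add: diff_divide_distrib[symmetric] algebra_simps)
  then have "\<bar>target p k t - popt k t\<bar> = real N * \<bar>?S - ?S'\<bar> / (M * c k t)"
    using abs_of_pos[OF Mc] by (simp only: abs_divide abs_mult abs_of_nat)
  also have "\<dots> \<le> real N * (D * ?S') / (M * c k t)"
    using S Mc by (intro divide_right_mono mult_left_mono) auto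
  also have "\<dots> = D * (real N * ?S' / (M * c k t))"
    by simp
  also have "\<dots> = (1 - slack / M) * D * popt k t"
    unfolding price_share[OF assms(2)] by simp
  finally show ?thesis .
qed

text \<open>
  The contraction factor while relative errors are at most \<open>D\<^sub>0\<close>.  Prices are then at most
  \<open>(1 + D\<^sub>0) B / slack\<close>, and as \<open>c \<ge> 1\<close> the relaxation is at least the reciprocal of the
  denominator below; \<open>slack / M\<close> is the share of the error that a full step to the target removes.
\<close>

definition factor :: "real \<Rightarrow> real" where
  "factor D\<^sub>0 = 1 - (slack / M) / (1 + \<delta> * ((1 + D\<^sub>0) * (B / slack)))"

lemma factor_bounds:
  assumes "D\<^sub>0 \<ge> 0"
  shows "0 \<le> factor D\<^sub>0" and "factor D\<^sub>0 < 1"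
proof -
  let ?d = "1 + \<delta> * ((1 + D\<^sub>0) * (B / slack))"
  have d: "?d \<ge> 1"
    using assms \<delta>_nonneg B_pos slack_pos by simp
  have s: "0 < slack / M" "slack / M \<le> 1"
    using slack_pos M_pos slack_le_M by auto
  have "slack / M / ?d > 0"
    using d by (intro divide_pos_pos[OF s(1)]) linarith
  moreover have "slack / M / ?d \<le> 1"
    using d s by (subst divide_le_eq_1_pos) auto
  ultimately show "0 \<le> factor D\<^sub>0" and "factor D\<^sub>0 < 1"
    by (auto simp: factor_def)
qed

lemma relaxation_lower_bound:
  assumes "positive p" and "rel_error_le D p" and "D \<le> D\<^sub>0" and "0 \<le> D" and "(k, t) \<in> grid"
  shows "1 / (1 + \<delta> * ((1 + D\<^sub>0) * (B / slack))) \<le> relaxation p k t"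
proof -
  have c: "c k t \<ge> 1"
    using c_ge_1 assms(5) .
  have p: "p k t > 0"
    using assms(1,5) by (auto simp: positive_def)
  have A: "B / slack > 0"
    using B_pos slack_pos by simp
  have "p k t \<le> (1 + D) * popt k t"
  proof -
    have "\<bar>p k t - popt k t\<bar> \<le> D * popt k t"
      using assms(2,5) unfolding rel_error_le_def by blast
    then show ?thesis
      unfolding distrib_right by linarith
  qed
  also have "\<dots> \<le> (1 + D\<^sub>0) * popt k t"
    using assms(3) popt_pos[OF assms(5)] by simp
  also have "popt k t \<le> B / slack"
    unfolding popt_eq using divide_left_mono[OF c, of "B / slack"] A c by simp
  then have "(1 + D\<^sub>0) * popt k t \<le> (1 + D\<^sub>0) * (B / slack)"
    using assms(3,4) by (intro mult_left_mono) auto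
  finally have bound: "p k t \<le> (1 + D\<^sub>0) * (B / slack)" .
  have "p k t / c k t \<le> p k t"
    using c p by (simp add: divide_le_eq mult_le_cancel_left1)
  then have le: "1 + \<delta> * (p k t / c k t) \<le> 1 + \<delta> * ((1 + D\<^sub>0) * (B / slack))"
    using bound \<delta>_nonneg by (intro add_left_mono mult_left_mono) auto
  have pos: "0 < 1 + \<delta> * (p k t / c k t)"
    using \<delta>_nonneg p c by (simp add: add_pos_nonneg)
  have "relaxation p k t = 1 / (1 + \<delta> * (p k t / c k t))"
    using c by (simp add: relaxation_def field_simps)
  then show ?thesis
    using divide_left_mono[OF le, of 1] pos le by simp
qed

lemma new_price_contracts:
  assumes "positive p" and "rel_error_le D p" and "0 \<le> D" and "D \<le> D\<^sub>0" and "(k, t) \<in> grid"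
  shows "\<bar>new_price K T N G b \<delta> p k t - popt k t\<bar> \<le> factor D\<^sub>0 * D * popt k t"
proof -
  let ?l = "relaxation p k t" and ?s = "slack / M"
  have p: "p k t > 0"
    using assms(1,5) by (auto simp: positive_def)
  note l = relaxation_bounds[of k t p, OF assms(5) p]
  have "new_price K T N G b \<delta> p k t - popt k t
      = (1 - ?l) * (p k t - popt k t) + ?l * (target p k t - popt k t)"
    unfolding new_price_relaxed[of k t p, OF assms(5) p] by (simp add: algebra_simps)
  then have "\<bar>new_price K T N G b \<delta> p k t - popt k t\<bar>
      \<le> (1 - ?l) * \<bar>p k t - popt k t\<bar> + ?l * \<bar>target p k t - popt k t\<bar>"
    using l abs_triangle_ineq[of "(1 - ?l) * (p k t - popt k t)" "?l * (target p k t - popt k t)"]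
    by (simp add: abs_mult)
  also have "\<dots> \<le> (1 - ?l) * (D * popt k t) + ?l * ((1 - ?s) * D * popt k t)"
    using l assms(2,5) target_contracts[OF assms(2,5)]
    by (intro add_mono mult_left_mono) (auto simp: rel_error_le_def)
  also have "\<dots> = (1 - ?s * ?l) * (D * popt k t)"
    by (simp add: algebra_simps)
  also have "\<dots> \<le> factor D\<^sub>0 * (D * popt k t)"
  proof (rule mult_right_mono)
    have "?s * (1 / (1 + \<delta> * ((1 + D\<^sub>0) * (B / slack)))) \<le> ?s * ?l"
      using relaxation_lower_bound[OF assms(1,2,4,3,5)] slack_pos M_pos
      by (intro mult_left_mono) auto
    then show "1 - ?s * ?l \<le> factor D\<^sub>0"
      by (simp add: factor_def)
    show "0 \<le> D * popt k t"
      using assms(3) popt_pos[OF assms(5)] by simp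
  qed
  finally show ?thesis
    by (simp add: mult.assoc)
qed

section \<open>One sweep over all pairs\<close>

text \<open>
  Within a sweep the processed pairs have relative error at most \<open>q D\<close> and the others at most
  \<open>D\<close>.  As \<open>q \<le> 1\<close>, all errors remain at most \<open>D\<close>, which is all that the next update needs.
\<close>

lemma partial_sweep_contracts:
  assumes "positive p" and "rel_error_le D p" and "0 \<le> D" and "D \<le> D\<^sub>0" and "set xs \<subseteq> grid"
  defines "r \<equiv> process_pairs K T N G b \<delta> xs p"
  shows "positive r \<and> (\<forall>(k, t)\<in>grid. \<bar>r k t - popt k t\<bar>
           \<le> (if (k, t) \<in> set xs then factor D\<^sub>0 * D else D) * popt k t)"
  using assms(5) unfolding r_def
proof (induction xs rule: rev_induct)
  case Nil
  then show ?case
    using assms(1,2) by (simp add: process_pairs_def rel_error_le_def)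
next
  case (snoc a xs)
  obtain k t where a: "a = (k, t)" by (cases a)
  let ?r = "process_pairs K T N G b \<delta> xs p"
  have kt: "(k, t) \<in> grid"
    using snoc.prems a by simp
  have IH: "positive ?r"
    "\<And>j h. (j, h) \<in> grid \<Longrightarrow> \<bar>?r j h - popt j h\<bar>
       \<le> (if (j, h) \<in> set xs then factor D\<^sub>0 * D else D) * popt j h"
    using snoc.IH snoc.prems by auto
  have q: "factor D\<^sub>0 * D \<le> D"
    using factor_bounds(2)[of D\<^sub>0] assms(3,4) by (simp add: mult_left_le_one_le factor_bounds(1))
  have "rel_error_le D ?r"
    unfolding rel_error_le_def
  proof (clarify, goal_cases)
    case (1 j h)
    then have jh: "(j, h) \<in> grid" by simp
    have "(if (j, h) \<in> set xs then factor D\<^sub>0 * D else D) * popt j h \<le> D * popt j h"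
      using q popt_pos[OF jh] by (intro mult_right_mono) auto
    with IH(2)[OF jh] show ?case
      by (rule order_trans)
  qed
  note new = new_price_contracts[OF IH(1) this assms(3,4) kt]
  have step: "process_pairs K T N G b \<delta> (xs @ [a]) p
      = ?r(k := (?r k)(t := new_price K T N G b \<delta> ?r k t))"
    by (simp add: process_pairs_def a)
  have "positive (process_pairs K T N G b \<delta> (xs @ [a]) p)"
    using IH(1) new_price_pos[OF IH(1) kt] by (auto simp: step positive_def)
  moreover have "\<bar>process_pairs K T N G b \<delta> (xs @ [a]) p j h - popt j h\<bar>
      \<le> (if (j, h) \<in> set (xs @ [a]) then factor D\<^sub>0 * D else D) * popt j h"
    if "(j, h) \<in> grid" for j h
  proof (cases "(j, h) = (k, t)")
    case True
    then show ?thesis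
      using new by (simp add: step[unfolded a] a)
  next
    case False
    then have "process_pairs K T N G b \<delta> (xs @ [a]) p j h = ?r j h"
      by (auto simp: step)
    moreover have "(j, h) \<in> set (xs @ [a]) \<longleftrightarrow> (j, h) \<in> set xs"
      using False a by auto
    ultimately show ?thesis
      using IH(2)[OF that] by presburger
  qed
  ultimately show ?case
    by blast
qed

lemma sweep_contracts:
  assumes "positive p" and "rel_error_le D p" and "0 \<le> D" and "D \<le> D\<^sub>0"
    and "processing_order K T xs"
  shows "positive (process_pairs K T N G b \<delta> xs p)"
    and "rel_error_le (factor D\<^sub>0 * D) (process_pairs K T N G b \<delta> xs p)"
proof -
  have xs: "set xs = grid"
    using assms(5) by (simp add: processing_order_def)
  show "positive (process_pairs K T N G b \<delta> xs p)"
    and "rel_error_le (factor D\<^sub>0 * D) (process_pairs K T N G b \<delta> xs p)"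
    using partial_sweep_contracts[OF assms(1-4), of xs] xs
    by (auto simp: rel_error_le_def)
qed

section \<open>The whole run\<close>

definition deviation :: "prices \<Rightarrow> real" where
  "deviation p = Max ((\<lambda>(k, t). \<bar>p k t - popt k t\<bar> / popt k t) ` grid)"

lemma deviation_le_iff: "deviation p \<le> D \<longleftrightarrow> rel_error_le D p"
proof -
  have "deviation p \<le> D \<longleftrightarrow> (\<forall>(k, t)\<in>grid. \<bar>p k t - popt k t\<bar> / popt k t \<le> D)"
    unfolding deviation_def using finite_grid grid_nonempty by (subst Max_le_iff) auto
  also have "\<dots> \<longleftrightarrow> rel_error_le D p"
    unfolding rel_error_le_def
  proof (intro ball_cong refl, clarify)
    fix k t assume "k \<in> {1..K}" "t \<in> {1..T}"
    then have "popt k t > 0"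
      by (simp add: popt_pos)
    then show "\<bar>p k t - popt k t\<bar> / popt k t \<le> D \<longleftrightarrow> \<bar>p k t - popt k t\<bar> \<le> D * popt k t"
      by (rule pos_divide_le_eq)
  qed
  finally show ?thesis .
qed

lemma deviation_nonneg: "deviation p \<ge> 0"
proof -
  have "\<bar>p 1 1 - popt 1 1\<bar> / popt 1 1 \<le> deviation p"
    unfolding deviation_def using finite_grid K_pos T_pos
    by (intro Max_ge) (auto intro!: image_eqI[where x = "(1, 1)"])
  moreover have "\<bar>p 1 1 - popt 1 1\<bar> / popt 1 1 \<ge> 0"
    using popt_pos[of 1 1] K_pos T_pos by simp
  ultimately show ?thesis
    by linarith
qed

lemma deviation_cong:
  assumes "\<forall>k\<in>{1..K}. \<forall>t\<in>{1..T}. p k t = p' k t"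
  shows "deviation p = deviation p'"
proof -
  have "(\<lambda>(k, t). \<bar>p k t - popt k t\<bar> / popt k t) ` grid
      = (\<lambda>(k, t). \<bar>p' k t - popt k t\<bar> / popt k t) ` grid"
    using assms by (intro image_cong) auto
  then show ?thesis
    by (simp add: deviation_def)
qed

text \<open>
  When the algorithm has stopped, some earlier iteration left the deviation unchanged although it
  multiplied it by at most \<open>q < 1\<close>.  The deviation therefore vanished there, and it cannot have
  grown since.
\<close>

lemma run_contracts:
  assumes run: "algorithm_run K T N G b \<delta> ord p"
  defines "q \<equiv> factor (deviation (p 0))"
  shows "positive (p i) \<and> deviation (p i) \<le> q ^ i * deviation (p 0)"
proof -
  let ?e = "\<lambda>i. deviation (p i)"
  note run' = run[unfolded algorithm_run_def]
  have init: "positive (p 0)"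
    using conjunct1[OF run'] by (auto simp: positive_def)
  have ord: "processing_order K T (ord i)" for i
    using conjunct1[OF conjunct2[OF run']] by (rule spec)
  have next_p: "p (Suc i) = (if stopped K T p i then p i
                  else process_pairs K T N G b \<delta> (ord i) (p i))" for i
    using conjunct2[OF conjunct2[OF run']] by (rule spec)
  have q: "0 \<le> q" "q < 1"
    using factor_bounds[OF deviation_nonneg] by (auto simp: q_def)
  have contr: "positive (p i) \<and> ?e i \<le> ?e 0 \<and> (\<forall>j<i. ?e (Suc j) \<le> q * ?e j)" for i
  proof (induction i)
    case 0
    show ?case
      by (simp add: init)
  next
    case (Suc i)
    have pos: "positive (p i)" and le: "?e i \<le> ?e 0"
      and IH: "\<And>j. j < i \<Longrightarrow> ?e (Suc j) \<le> q * ?e j"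
      using Suc.IH by auto
    have step: "positive (p (Suc i)) \<and> ?e (Suc i) \<le> q * ?e i"
    proof (cases "stopped K T p i")
      case True
      then obtain j where j: "j < i" "\<forall>k\<in>{1..K}. \<forall>t\<in>{1..T}. p (Suc j) k t = p j k t"
        by (auto simp: stopped_def)
      have "?e j \<le> q * ?e j"
        using IH[OF j(1)] deviation_cong[OF j(2)] by simp
      then have "(1 - q) * ?e j \<le> 0"
        by (simp add: algebra_simps)
      then have j0: "?e j = 0"
        using q(2) deviation_nonneg[of "p j"] by (simp add: mult_le_0_iff)
      have "m \<le> i \<Longrightarrow> ?e m = 0" if "j \<le> m" for m
        using that
      proof (induction m rule: dec_induct)
        case base
        show ?case by (rule j0)
      next
        case (step m)
        then show ?case
          using IH[of m] deviation_nonneg[of "p (Suc m)"] by simp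
      qed
      then have "?e i = 0"
        using j(1) by simp
      moreover have "p (Suc i) = p i"
        by (simp only: next_p[of i] True if_True)
      ultimately show ?thesis
        using pos by simp
    next
      case False
      have "rel_error_le (?e i) (p i)"
        using deviation_le_iff by blast
      from sweep_contracts[OF pos this deviation_nonneg le ord[of i]] show ?thesis
        unfolding next_p[of i] if_not_P[OF False] deviation_le_iff q_def by blast
    qed
    have "q * ?e i \<le> ?e i"
      using q deviation_nonneg[of "p i"] by (simp add: mult_left_le_one_le)
    then have "?e (Suc i) \<le> ?e 0"
      using step le by linarith
    moreover have "?e (Suc j) \<le> q * ?e j" if "j < Suc i" for j
      using that IH[of j] step by (cases "j = i") auto
    ultimately show ?case
      using step by blast
  qed
  have "?e i \<le> q ^ i * ?e 0"
  proof (induction i)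
    case (Suc i)
    have "?e (Suc i) \<le> q * ?e i"
      using contr[of "Suc i"] by simp
    also have "\<dots> \<le> q * (q ^ i * ?e 0)"
      using Suc.IH q(1) by (rule mult_left_mono)
    finally show ?case
      by (simp add: mult.assoc)
  qed simp
  then show ?thesis
    using contr by blast
qed

lemma run_converges:
  assumes run: "algorithm_run K T N G b \<delta> ord p" and kt: "(k, t) \<in> grid"
  shows "(\<lambda>i. p i k t) \<longlonglongrightarrow> popt k t"
proof -
  define q where "q = factor (deviation (p 0))"
  have q: "0 \<le> q" "q < 1"
    using factor_bounds[OF deviation_nonneg] by (auto simp: q_def)
  have bound: "\<bar>p i k t - popt k t\<bar> \<le> q ^ i * deviation (p 0) * popt k t" for i
  proof -
    have "rel_error_le (q ^ i * deviation (p 0)) (p i)"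
      using run_contracts[OF run, of i] by (simp only: deviation_le_iff q_def)
    then show ?thesis
      using kt unfolding rel_error_le_def by blast
  qed
  have decay: "(\<lambda>i. q ^ i * deviation (p 0) * popt k t) \<longlonglongrightarrow> 0"
    using LIMSEQ_realpow_zero[OF q] by (intro tendsto_mult_left_zero)
  have "(\<lambda>i. \<bar>p i k t - popt k t\<bar>) \<longlonglongrightarrow> 0"
  proof (rule tendsto_sandwich[OF _ _ tendsto_const decay])
    show "\<forall>\<^sub>F i in sequentially. 0 \<le> \<bar>p i k t - popt k t\<bar>"
      by simp
    show "\<forall>\<^sub>F i in sequentially.
        \<bar>p i k t - popt k t\<bar> \<le> q ^ i * deviation (p 0) * popt k t"
      using bound by (intro always_eventually allI)
  qed
  then show ?thesis
    by (rule LIM_zero_cancel[OF tendsto_rabs_zero_cancel])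
qed

end

theorem theorem4:
  fixes K T N :: nat
    and G :: "nat \<Rightarrow> nat \<Rightarrow> real"
    and b Emin :: "nat \<Rightarrow> real"
    and \<delta> :: real
    and ord :: "nat \<Rightarrow> (nat \<times> nat) list"
    and p :: "nat \<Rightarrow> prices"
  assumes "\<And>k t. k \<in> {1..K} \<Longrightarrow> t \<in> {1..T} \<Longrightarrow> G k t > 0"
    and "\<And>n. n \<in> {1..N} \<Longrightarrow> b n \<ge> 0"
    and "(\<Sum>n\<in>{1..N}. b n) > 0"
    and "\<And>n. n \<in> {1..N} \<Longrightarrow> Emin n \<ge> 0"
    and "\<delta> \<ge> 0"
    and "algorithm_run K T N G b \<delta> ord p"
    and "\<And>n q. n \<in> {1..N} \<Longrightarrow> q \<in> announced_prices K T N G b \<delta> ord p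
           \<Longrightarrow> budget_sufficient K T (b n) (Emin n) q"
  shows "\<forall>k\<in>{1..K}. \<forall>t\<in>{1..T}. (\<lambda>i. p i k t) \<longlonglongrightarrow> optimal_price K T N G b k t"
proof (intro ballI)
  fix k t assume kt: "k \<in> {1..K}" "t \<in> {1..T}"
  interpret market K T N G b \<delta>
    using kt assms(1,3,5) by unfold_locales auto
  show "(\<lambda>i. p i k t) \<longlonglongrightarrow> optimal_price K T N G b k t"
    using run_converges[OF assms(6)] kt by simp
qed

end
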